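(* Let $\mathcal{B}=(e_n)_{n=1}^\infty$ be a basis of a Banach space $\mathbb{X}$ and let $\omega$ be a weight on subsets of $\mathbb{N}$. (1) If $\mathcal{B}$ is $C$-$\omega$-almost greedy, then $\mathcal{B}$ is $C$-suppression quasi-greedy and satisfies $C$-$\omega$-Property (A). (2) If $\mathcal{B}$ is $C_\ell$-suppression quasi-greedy and satisfies $C$-$\omega$-Property (A), then $\mathcal{B}$ is $C_\ell C$-$\omega$-almost greedy.
   Context: $\mathbb{X}$ is a Banach space over $\mathbb{K}=\mathbb{R}$ or $\mathbb{C}$. A basis of $\mathbb{X}$ means a semi-normalized Schauder basis $(e_n)_{n=1}^\infty$, i.e. $0<\inf_n\|e_n\|\le\sup_n\|e_n\|<\infty$, with biorthogonal functionals $(e_n^* )_{n=1}^\infty\subset\mathbb{X}^*$. $\mathbb{N}^{<\infty}$ is the set of finite subsets of $\mathbb{N}$. A weight on sets is a function $\omega:\mathcal{P}(\mathbb{N})\to[0,\infty]$, whose value at $A$ is written $w(A)$, such that $w(\emptyset)=0$ and $w(A)\in(0,\infty]$ for every nonempty $A\subset\mathbb{N}$. Greedy sets: for $x\in\mathbb{X}$, $m\in\mathbb{N}$, a greedy set of order $m$ of $x$ is a set $\Lambda_m(x)\subset\mathbb{N}$ with $|\Lambda_m(x)|=m$ and $\min_{n\in\Lambda_m(x)}|e_n^*(x)|\ge\max_{n\notin\Lambda_m(x)}|e_n^*(x)|$; the corresponding greedy sum is $G_m(x)=\sum_{n\in\Lambda_m(x)}e_n^*(x)e_n$. $\mathcal{B}$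 is $C$-$\omega$-almost greedy ($C\ge1$) if for all $x\in\mathbb{X}$, $m\in\mathbb{N}$ and all greedy sets $\Lambda_m(x)$, $\|x-G_m(x)\|\le C\widetilde{\sigma}^\omega_{\Lambda_m(x)}(x)$, where for $B\subset\mathbb{N}$ $$\widetilde\sigma^\omega_B(x)=\inf\{\|x-P_A(x)\|: A\in\mathbb{N}^{<\infty},\ w(A\setminus B)\le w(B\setminus A)\},\qquad P_A(x)=\sum_{n\in A}e_n^*(x)e_n.$$ $\mathcal{B}$ is $C$-suppression quasi-greedy ($C\ge1$) if $\|x-G_m(x)\|\le C\|x\|$ for all $x\in\mathbb{X}$, $m\in\mathbb{N}$ and all greedy sets $\Lambda_m(x)$. Signs: $\varepsilon=(\varepsilon_n)_{n=1}^\infty\subset\mathbb{K}$ with $|\varepsilon_n|=1$; $1_{\varepsilon A}=\sum_{n\in A}\varepsilon_ne_n$. $\operatorname{supp}(x)=\{n:e_n^*(x)\ne0\}$, $\|x\|_\infty=\sup_n|e_n^*(x)|$. $\mathcal{B}$ satisfies $C$-$\omega$-Property (A) ($C\ge1$) if $\|x+1_{\varepsilon A}\|\le C\|x+1_{\delta B}\|$ for all $A,B\in\mathbb{N}^{<\infty}$ with $w(A)\le w(B)$, all signs $\varepsilon,\delta$, and all $x\in\mathbb{X}$ with $\|x\|_\infty\le1$ such that $A$, $B$, $\operatorname{supp}(x)$ are pairwise disjoint. *)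

theory Defs
  imports Complex_Main "HOL-Library.Extended_Nonnegative_Real"
begin

text \<open>
  The scalar field is a type of class real_normed_field. Its norm is multiplicative, so by the
  Gelfand--Mazur theorem such a field is isometrically isomorphic to the reals or to the complex
  numbers. Both types are instances of the class, and a complex Banach space is a type of
  class banach together with a compatible complex scalar multiplication.
\<close>

locale banach_space_over = vector_space scl
  for scl :: "'k::real_normed_field \<Rightarrow> 'a::banach \<Rightarrow> 'a" +
  assumes norm_scl: "norm (scl c x) = norm c * norm x"
    and scl_of_real: "scl (of_real r) x = r *\<^sub>R x"

text \<open>The index set of a basis is the type of natural numbers, so indices start at 0.\<close>

definition schauder_basis :: "('k::real_normed_field \<Rightarrow> 'a::banach \<Rightarrow> 'a) \<Rightarrow> (nat \<Rightarrow> 'a) \<Rightarrow> bool" where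
  "schauder_basis scl e \<longleftrightarrow> (\<forall>x. \<exists>!a. (\<lambda>n. scl (a n) (e n)) sums x)"

definition semi_normalized :: "(nat \<Rightarrow> 'a::banach) \<Rightarrow> bool" where
  "semi_normalized e \<longleftrightarrow> 0 < (INF n. norm (e n)) \<and> bdd_above (range (\<lambda>n. norm (e n)))"

definition basis :: "('k::real_normed_field \<Rightarrow> 'a::banach \<Rightarrow> 'a) \<Rightarrow> (nat \<Rightarrow> 'a) \<Rightarrow> bool" where
  "basis scl e \<longleftrightarrow> schauder_basis scl e \<and> semi_normalized e"

text \<open>
  The biorthogonal functionals of a Schauder basis: the value at x of the n-th functional is the
  n-th coefficient of the expansion of x. On a Banach space they are automatically continuous.
\<close>

definition coord :: "('k::real_normed_field \<Rightarrow> 'a::banach \<Rightarrow> 'a) \<Rightarrow> (nat \<Rightarrow> 'a) \<Rightarrow> nat \<Rightarrow> 'a \<Rightarrow> 'k" where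
  "coord scl e n x = (THE a. (\<lambda>k. scl (a k) (e k)) sums x) n"

definition proj :: "('k::real_normed_field \<Rightarrow> 'a::banach \<Rightarrow> 'a) \<Rightarrow> (nat \<Rightarrow> 'a) \<Rightarrow> nat set \<Rightarrow> 'a \<Rightarrow> 'a" where
  "proj scl e A x = (\<Sum>n\<in>A. scl (coord scl e n x) (e n))"

definition supp :: "('k::real_normed_field \<Rightarrow> 'a::banach \<Rightarrow> 'a) \<Rightarrow> (nat \<Rightarrow> 'a) \<Rightarrow> 'a \<Rightarrow> nat set" where
  "supp scl e x = {n. coord scl e n x \<noteq> 0}"

text \<open>
  For a semi-normalized Schauder basis the coefficients of x tend to 0, so the supremum below is
  that of a bounded set.
\<close>

definition sup_norm :: "('k::real_normed_field \<Rightarrow> 'a::banach \<Rightarrow> 'a) \<Rightarrow> (nat \<Rightarrow> 'a) \<Rightarrow> 'a \<Rightarrow> real" where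
  "sup_norm scl e x = (SUP n. norm (coord scl e n x))"

definition signs :: "(nat \<Rightarrow> 'k::real_normed_field) \<Rightarrow> bool" where
  "signs \<epsilon> \<longleftrightarrow> (\<forall>n. norm (\<epsilon> n) = 1)"

definition signed_sum ::
  "('k::real_normed_field \<Rightarrow> 'a::banach \<Rightarrow> 'a) \<Rightarrow> (nat \<Rightarrow> 'a) \<Rightarrow> (nat \<Rightarrow> 'k) \<Rightarrow> nat set \<Rightarrow> 'a" where
  "signed_sum scl e \<epsilon> A = (\<Sum>n\<in>A. scl (\<epsilon> n) (e n))"

definition weight :: "(nat set \<Rightarrow> ennreal) \<Rightarrow> bool" where
  "weight w \<longleftrightarrow> w {} = 0 \<and> (\<forall>A. A \<noteq> {} \<longrightarrow> 0 < w A)"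

definition greedy_set ::
  "('k::real_normed_field \<Rightarrow> 'a::banach \<Rightarrow> 'a) \<Rightarrow> (nat \<Rightarrow> 'a) \<Rightarrow> 'a \<Rightarrow> nat \<Rightarrow> nat set \<Rightarrow> bool" where
  "greedy_set scl e x m \<Lambda> \<longleftrightarrow> finite \<Lambda> \<and> card \<Lambda> = m \<and>
     (\<forall>n\<in>\<Lambda>. \<forall>k. k \<notin> \<Lambda> \<longrightarrow> norm (coord scl e n x) \<ge> norm (coord scl e k x))"

text \<open>The infimum is used only for finite B; the set is then nonempty, as A = B is admissible.\<close>

definition sigma_tilde ::
  "('k::real_normed_field \<Rightarrow> 'a::banach \<Rightarrow> 'a) \<Rightarrow> (nat \<Rightarrow> 'a) \<Rightarrow> (nat set \<Rightarrow> ennreal) \<Rightarrow> nat set \<Rightarrow> 'a \<Rightarrow> real" where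
  "sigma_tilde scl e w B x =
     (INF A\<in>{A. finite A \<and> w (A - B) \<le> w (B - A)}. norm (x - proj scl e A x))"

definition almost_greedy ::
  "('k::real_normed_field \<Rightarrow> 'a::banach \<Rightarrow> 'a) \<Rightarrow> (nat \<Rightarrow> 'a) \<Rightarrow> (nat set \<Rightarrow> ennreal) \<Rightarrow> real \<Rightarrow> bool" where
  "almost_greedy scl e w C \<longleftrightarrow> C \<ge> 1 \<and>
     (\<forall>x m \<Lambda>. m \<ge> 1 \<longrightarrow> greedy_set scl e x m \<Lambda> \<longrightarrow>
        norm (x - proj scl e \<Lambda> x) \<le> C * sigma_tilde scl e w \<Lambda> x)"

definition suppression_quasi_greedy ::
  "('k::real_normed_field \<Rightarrow> 'a::banach \<Rightarrow> 'a) \<Rightarrow> (nat \<Rightarrow> 'a) \<Rightarrow> real \<Rightarrow> bool" where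
  "suppression_quasi_greedy scl e C \<longleftrightarrow> C \<ge> 1 \<and>
     (\<forall>x m \<Lambda>. m \<ge> 1 \<longrightarrow> greedy_set scl e x m \<Lambda> \<longrightarrow>
        norm (x - proj scl e \<Lambda> x) \<le> C * norm x)"

definition property_A ::
  "('k::real_normed_field \<Rightarrow> 'a::banach \<Rightarrow> 'a) \<Rightarrow> (nat \<Rightarrow> 'a) \<Rightarrow> (nat set \<Rightarrow> ennreal) \<Rightarrow> real \<Rightarrow> bool" where
  "property_A scl e w C \<longleftrightarrow> C \<ge> 1 \<and>
     (\<forall>A B \<epsilon> \<delta> x. finite A \<longrightarrow> finite B \<longrightarrow> w A \<le> w B \<longrightarrow> signs \<epsilon> \<longrightarrow> signs \<delta> \<longrightarrow>
        sup_norm scl e x \<le> 1 \<longrightarrow>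
        A \<inter> B = {} \<longrightarrow> A \<inter> supp scl e x = {} \<longrightarrow> B \<inter> supp scl e x = {} \<longrightarrow>
        norm (x + signed_sum scl e \<epsilon> A) \<le> C * norm (x + signed_sum scl e \<delta> B))"

end

theory Submission imports Defs begin

text \<open>
  For the first part, Property (A) is the almost greedy inequality for the vector
  \<open>x + 1\<^sub>\<epsilon>\<^sub>A + 1\<^sub>\<delta>\<^sub>B\<close>, whose greedy set \<open>B\<close> competes with \<open>A\<close>.
  For the second part let \<open>\<alpha>\<close> be the least modulus of a coefficient of \<open>x\<close> on \<open>\<Lambda> - A\<close>
  and \<open>y = x - P x\<close> with \<open>P\<close> the projection on \<open>A \<union> \<Lambda>\<close>. By convexity the norm of
  \<open>x - G x\<close> is dominated by those of \<open>y\<close> plus \<open>\<alpha>\<close> times signed sums over \<open>A - \<Lambda>\<close>, Property (A)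
  moves the signed sum to \<open>\<Lambda> - A\<close>, and the vector obtained is a truncation of \<open>x - P\<^sub>A x\<close>, that is,
  a convex combination of the vectors obtained from \<open>x - P\<^sub>A x\<close> by removing greedy sums.
\<close>

section \<open>Convexity estimates for weighted and signed sums\<close>

text \<open>Layer cake: the sets \<open>S\<close> in the last hypothesis are the superlevel sets of \<open>f\<close>.\<close>

lemma norm_diff_weighted_sum_le:
  fixes u :: "'a::real_normed_vector"
  assumes "finite B" and "a \<ge> 0"
    and "\<And>n. n \<in> B \<Longrightarrow> 0 \<le> f n \<and> f n \<le> a"
    and "\<And>S. S \<subseteq> B \<Longrightarrow> \<forall>n\<in>S. \<forall>k\<in>B - S. f k < f n \<Longrightarrow> norm (u - (\<Sum>n\<in>S. v n)) \<le> M"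
  shows "norm (a *\<^sub>R u - (\<Sum>n\<in>B. f n *\<^sub>R v n)) \<le> a * M"
  using assms
proof (induction B arbitrary: a f rule: finite_psubset_induct)
  case (psubset B)
  show ?case
  proof (cases "B = {}")
    case True
    then show ?thesis
      using psubset.prems(3)[of "{}"] psubset.prems(1) by (simp add: mult_left_mono)
  next
    case False
    \<comment> \<open>The smallest value \<open>m\<close> is peeled off both \<open>f\<close> and
      \<open>a\<close>. The minimizer \<open>n0\<close> then drops out of the support
      \<open>B'\<close>, so the induction hypothesis applies to a smaller set.\<close>
    define m where "m = Min (f ` B)"
    have m_le: "m \<le> f n" if "n \<in> B" for n
      using that psubset.hyps unfolding m_def by simp
    obtain n0 where n0: "n0 \<in> B" "f n0 = m"
      using False psubset.hyps Min_in[of "f ` B"] unfolding m_def by fastforce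
    define B' where "B' = {n \<in> B. m < f n}"
    have B': "B' \<subset> B"
      using n0 unfolding B'_def by auto
    have m: "0 \<le> m" "m \<le> a"
      using psubset.prems(2)[OF n0(1)] n0(2) by auto
    have 1: "norm ((a - m) *\<^sub>R u - (\<Sum>n\<in>B'. (f n - m) *\<^sub>R v n)) \<le> (a - m) * M"
    proof (rule psubset.IH[OF B'])
      show "0 \<le> f n - m \<and> f n - m \<le> a - m" if "n \<in> B'" for n
        using that psubset.prems(2)[of n] by (auto simp: B'_def)
      fix S assume S: "S \<subseteq> B'" "\<forall>n\<in>S. \<forall>k\<in>B' - S. f k - m < f n - m"
      \<comment> \<open>A superlevel set of \<open>f - m\<close> within \<open>B'\<close> is one of
        \<open>f\<close> within \<open>B\<close>, because \<open>f\<close> stays at \<open>m\<close>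
        or below on the rest of \<open>B\<close>.\<close>
      have "f k < f n" if "n \<in> S" "k \<in> B - S" for n k
      proof (cases "k \<in> B'")
        case True
        then show ?thesis using S(2) that by force
      next
        case False
        then have "f k \<le> m" using that by (auto simp: B'_def)
        moreover have "m < f n" using that S(1) by (auto simp: B'_def)
        ultimately show ?thesis by simp
      qed
      then show "norm (u - (\<Sum>n\<in>S. v n)) \<le> M"
        using S(1) B' by (intro psubset.prems(3)) auto
    qed (use m in simp)
    \<comment> \<open>The set \<open>S = B\<close> satisfies the superlevel condition
      vacuously.\<close>
    have 2: "norm (m *\<^sub>R (u - (\<Sum>n\<in>B. v n))) \<le> m * M"
      using psubset.prems(3)[of B] m by (simp add: mult_left_mono)
    have "(\<Sum>n\<in>B'. (f n - m) *\<^sub>R v n) = (\<Sum>n\<in>B. (f n - m) *\<^sub>R v n)"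
    proof (rule sum.mono_neutral_left)
      show "\<forall>n\<in>B - B'. (f n - m) *\<^sub>R v n = 0"
        using m_le by (force simp: B'_def)
    qed (use psubset.hyps B' in auto)
    then have "a *\<^sub>R u - (\<Sum>n\<in>B. f n *\<^sub>R v n) =
        m *\<^sub>R (u - (\<Sum>n\<in>B. v n)) + ((a - m) *\<^sub>R u - (\<Sum>n\<in>B'. (f n - m) *\<^sub>R v n))"
      by (simp add: algebra_simps sum_subtractf scaleR_sum_right)
    then show ?thesis
      using norm_triangle_mono[OF 2 1] by (simp add: algebra_simps)
  qed
qed

text \<open>A scalar of modulus at most \<alpha> lies on the segment between two opposite scalars of
  modulus \<alpha>. Replacing the coefficients one at a time thus gives convex combinations of
  signed sums, for real and complex scalars alike.\<close>

lemma (in banach_space_over) norm_add_sum_le_if_signed_sums: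
  assumes "finite A" and "\<alpha> > 0" and "\<And>n. n \<in> A \<Longrightarrow> norm (a n) \<le> \<alpha>"
    and "\<And>\<epsilon>. signs \<epsilon> \<Longrightarrow> norm (y + \<alpha> *\<^sub>R signed_sum scl e \<epsilon> A) \<le> M"
  shows "norm (y + (\<Sum>n\<in>A. scl (a n) (e n))) \<le> M"
  using assms
proof (induction A arbitrary: y rule: finite_induct)
  case empty
  then show ?case
    using empty.prems(3)[of "\<lambda>_. 1"] by (simp add: signs_def signed_sum_def)
next
  case (insert n A)
  \<comment> \<open>The phase of \<open>a n\<close>, with default 1 so that \<open>u\<close> has
    norm 1 even if \<open>a n = 0\<close>.\<close>
  define u where "u = (if a n = 0 then 1 else a n / of_real (norm (a n)))"
  have u: "norm u = 1" "a n = of_real (norm (a n)) * u"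
    by (auto simp: u_def norm_divide)
  \<comment> \<open>The solution of \<open>norm (a n) = (2 * r - 1) * \<alpha>\<close>: the weight
    of the endpoint \<open>\<alpha> u\<close> against \<open>- \<alpha> u\<close>.\<close>
  define r where "r = (1 + norm (a n) / \<alpha>) / 2"
  have r: "0 \<le> r" "0 \<le> 1 - r" "norm (a n) = r * \<alpha> - (1 - r) * \<alpha>"
    using insert.prems(1) insert.prems(2)[of n] by (auto simp: r_def field_simps)
  have scl_an: "scl (a n) (e n) = (r * \<alpha>) *\<^sub>R scl u (e n) + ((1 - r) * \<alpha>) *\<^sub>R scl (- u) (e n)"
  proof -
    have "scl (a n) (e n) = norm (a n) *\<^sub>R scl u (e n)"
      by (subst u(2)) (simp only: scl_of_real flip: scale_scale)
    then show ?thesis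
      unfolding r(3) by (simp add: scaleR_diff_left)
  qed
  \<comment> \<open>The induction hypothesis will be used with the \<open>n\<close>-th term absorbed
    into \<open>y\<close>.\<close>
  have "norm (y + scl (a n) (e n) + \<alpha> *\<^sub>R signed_sum scl e \<epsilon> A) \<le> M" if \<epsilon>: "signs \<epsilon>" for \<epsilon>
  proof -
    let ?z = "\<lambda>s. y + \<alpha> *\<^sub>R (scl s (e n) + signed_sum scl e \<epsilon> A)"
    have bound: "norm (?z s) \<le> M" if "norm s = 1" for s
    proof -
      have "signed_sum scl e (\<epsilon>(n := s)) (insert n A) = scl s (e n) + signed_sum scl e \<epsilon> A"
        using insert.hyps by (auto simp: signed_sum_def intro!: sum.cong)
      moreover have "signs (\<epsilon>(n := s))"
        using \<epsilon> that by (simp add: signs_def)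
      ultimately show ?thesis
        using insert.prems(3) by metis
    qed
    have "y + scl (a n) (e n) + \<alpha> *\<^sub>R signed_sum scl e \<epsilon> A = r *\<^sub>R ?z u + (1 - r) *\<^sub>R ?z (- u)"
      unfolding scl_an by (simp add: algebra_simps)
    also have "norm \<dots> \<le> r * M + (1 - r) * M"
      using r(1,2) bound[of u] bound[of "- u"] u(1)
      by (intro norm_triangle_mono) (simp_all add: mult_left_mono)
    finally show ?thesis
      by (simp add: algebra_simps)
  qed
  then have "norm (y + scl (a n) (e n) + (\<Sum>k\<in>A. scl (a k) (e k))) \<le> M"
    using insert.prems(1,2) by (intro insert.IH) auto
  then show ?case
    using insert.hyps by (simp add: add.assoc)
qed

section \<open>Coordinates with respect to a basis\<close>

locale banach_space_with_basis = banach_space_over scl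
  for scl :: "'k::real_normed_field \<Rightarrow> 'a::banach \<Rightarrow> 'a" +
  fixes e :: "nat \<Rightarrow> 'a"
  assumes basis: "basis scl e"
begin

abbreviation "crd \<equiv> coord scl e"
abbreviation "prj \<equiv> proj scl e"

lemma ex1_expansion: "\<exists>!a. (\<lambda>n. scl (a n) (e n)) sums x"
  using basis by (simp add: basis_def schauder_basis_def)

lemma coord_sums: "(\<lambda>n. scl (crd n x) (e n)) sums x"
  using theI'[OF ex1_expansion[of x]] by (simp add: coord_def)

lemma coord_eqI: "(\<lambda>n. scl (a n) (e n)) sums x \<Longrightarrow> crd n x = a n"
  using the1_equality[OF ex1_expansion[of x]] by (simp add: coord_def)

lemma coord_add: "crd n (x + y) = crd n x + crd n y"
  using sums_add[OF coord_sums[of x] coord_sums[of y]]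
  by (intro coord_eqI) (simp add: scale_left_distrib)

lemma coord_diff: "crd n (x - y) = crd n x - crd n y"
  using sums_diff[OF coord_sums[of x] coord_sums[of y]]
  by (intro coord_eqI) (simp add: scale_left_diff_distrib)

lemma coord_scaleR: "crd n (r *\<^sub>R x) = of_real r * crd n x"
  using sums_scaleR_right[OF coord_sums[of x], of r]
  by (intro coord_eqI) (simp add: scl_of_real flip: scale_scale)

lemma coord_sum:
  assumes "finite A"
  shows "crd n (\<Sum>k\<in>A. scl (a k) (e k)) = (if n \<in> A then a n else 0)"
proof -
  have "(\<lambda>k. if k \<in> A then scl (a k) (e k) else 0) sums (\<Sum>k\<in>A. scl (a k) (e k))"
    using assms by (rule sums_If_finite_set)
  also have "(\<lambda>k. if k \<in> A then scl (a k) (e k) else 0) = (\<lambda>k. scl (if k \<in> A then a k else 0) (e k))"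
    by auto
  finally show ?thesis
    by (rule coord_eqI)
qed

lemma coord_signed_sum:
  "finite A \<Longrightarrow> crd n (signed_sum scl e \<epsilon> A) = (if n \<in> A then \<epsilon> n else 0)"
  unfolding signed_sum_def by (rule coord_sum)

lemma coord_proj: "finite A \<Longrightarrow> crd n (prj A x) = (if n \<in> A then crd n x else 0)"
  unfolding proj_def by (rule coord_sum)

lemma eq_zero_if_coord_zero:
  assumes "\<And>n. crd n x = 0"
  shows "x = 0"
  using coord_sums[of x] by (simp add: assms sums_iff)

text \<open>The terms of a convergent series are bounded, and the norms of the basis vectors are
  bounded away from 0. This makes the supremum in \<open>sup_norm\<close> a genuine upper
  bound.\<close>

lemma bdd_above_coord: "bdd_above (range (\<lambda>n. norm (crd n x)))"
proof -
  define c where "c = (INF n. norm (e n))"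
  have c: "c > 0"
    using basis by (simp add: basis_def semi_normalized_def c_def)
  have c_le: "c \<le> norm (e n)" for n
    unfolding c_def by (rule cINF_lower) (auto intro!: bdd_belowI[where m = 0])
  have "Bseq (\<lambda>n. scl (crd n x) (e n))"
    using coord_sums[of x] by (blast intro: convergent_imp_Bseq convergentI summable_LIMSEQ_zero sums_summable)
  then obtain K where K: "\<And>n. norm (crd n x) * norm (e n) \<le> K"
    unfolding Bseq_def norm_scl by blast
  have "norm (crd n x) \<le> K / c" for n
    using K[of n] mult_left_mono[OF c_le[of n], of "norm (crd n x)"] c by (simp add: field_simps)
  then show ?thesis
    by (intro bdd_aboveI2)
qed

lemma norm_coord_le_sup_norm: "norm (crd n x) \<le> sup_norm scl e x"
  unfolding sup_norm_def by (rule cSUP_upper[OF UNIV_I bdd_above_coord])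

section \<open>Passing between the infimum and individual competitors\<close>

lemma sigma_tilde_le:
  assumes "finite A" and "w (A - B) \<le> w (B - A)"
  shows "sigma_tilde scl e w B x \<le> norm (x - prj A x)"
  unfolding sigma_tilde_def using assms
  by (intro cINF_lower) (auto intro!: bdd_belowI[where m = 0])

lemma almost_greedyI:
  assumes "C \<ge> 1"
    and "\<And>x m \<Lambda> A. m \<ge> 1 \<Longrightarrow> greedy_set scl e x m \<Lambda> \<Longrightarrow> finite A \<Longrightarrow> w (A - \<Lambda>) \<le> w (\<Lambda> - A) \<Longrightarrow>
      norm (x - prj \<Lambda> x) \<le> C * norm (x - prj A x)"
  shows "almost_greedy scl e w C"
  unfolding almost_greedy_def
proof (intro conjI allI impI)
  fix x m \<Lambda> assume m: "1 \<le> m" and \<Lambda>: "greedy_set scl e x m \<Lambda>"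
  have "norm (x - prj \<Lambda> x) / C \<le> sigma_tilde scl e w \<Lambda> x"
    unfolding sigma_tilde_def
  proof (rule cINF_greatest)
    have "\<Lambda> \<in> {A. finite A \<and> w (A - \<Lambda>) \<le> w (\<Lambda> - A)}"
      using \<Lambda> by (simp add: greedy_set_def)
    then show "{A. finite A \<and> w (A - \<Lambda>) \<le> w (\<Lambda> - A)} \<noteq> {}"
      by blast
  qed (use assms(1) assms(2)[OF m \<Lambda>] in \<open>auto simp: field_simps\<close>)
  then show "norm (x - prj \<Lambda> x) \<le> C * sigma_tilde scl e w \<Lambda> x"
    using assms(1) by (simp add: field_simps)
qed (rule assms(1))

section \<open>Consequences of almost greediness\<close>

text \<open>The empty set is an admissible competitor, since \<open>w {} = 0\<close>, and its
  projection is 0.\<close>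

lemma almost_greedy_imp_suppression_quasi_greedy:
  assumes "weight w" and ag: "almost_greedy scl e w C"
  shows "suppression_quasi_greedy scl e C"
  unfolding suppression_quasi_greedy_def
proof (intro conjI allI impI)
  show C: "1 \<le> C"
    using ag by (simp add: almost_greedy_def)
  fix x m \<Lambda> assume "1 \<le> m" "greedy_set scl e x m \<Lambda>"
  then have "norm (x - prj \<Lambda> x) \<le> C * sigma_tilde scl e w \<Lambda> x"
    using ag by (simp add: almost_greedy_def)
  also have "\<dots> \<le> C * norm (x - prj {} x)"
    using assms(1) C by (intro mult_left_mono sigma_tilde_le) (auto simp: weight_def)
  finally show "norm (x - prj \<Lambda> x) \<le> C * norm x"
    by (simp add: proj_def)
qed

lemma almost_greedy_imp_property_A:
  assumes "weight w" and ag: "almost_greedy scl e w C"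
  shows "property_A scl e w C"
  unfolding property_A_def
proof (intro conjI allI impI)
  show C: "1 \<le> C"
    using ag by (simp add: almost_greedy_def)
  fix A B x and \<epsilon> \<delta> :: "nat \<Rightarrow> 'k"
  assume fin: "finite A" "finite B" and wAB: "w A \<le> w B" and sg: "signs \<epsilon>" "signs \<delta>"
    and x: "sup_norm scl e x \<le> 1"
    and dj: "A \<inter> B = {}" "A \<inter> supp scl e x = {}" "B \<inter> supp scl e x = {}"
  show "norm (x + signed_sum scl e \<epsilon> A) \<le> C * norm (x + signed_sum scl e \<delta> B)"
  \<comment> \<open>Greedy sets of order 0 are excluded, so empty \<open>B\<close> is separate:
    \<open>w A \<le> 0\<close> then forces \<open>A\<close> to be empty.\<close>
  proof (cases "B = {}")
    case True
    then have "A = {}"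
      using wAB assms(1) by (metis weight_def not_less)
    then show ?thesis
      using True C by (simp add: signed_sum_def mult_le_cancel_right1)
  next
    case False
    \<comment> \<open>Removing the part on \<open>B\<close> leaves the left side of Property (A),
      removing the part on \<open>A\<close> leaves the right side.\<close>
    define y where "y = x + signed_sum scl e \<epsilon> A + signed_sum scl e \<delta> B"
    have crd_y: "crd n y = crd n x + (if n \<in> A then \<epsilon> n else 0) + (if n \<in> B then \<delta> n else 0)" for n
      using fin by (simp add: y_def coord_add coord_signed_sum)
    have x_A: "crd n x = 0" if "n \<in> A" for n
      using dj that by (auto simp: supp_def)
    have x_B: "crd n x = 0" if "n \<in> B" for n
      using dj that by (auto simp: supp_def)
    have "norm (crd n y) = 1" if "n \<in> B" for n
      using that dj(1) sg x_B by (auto simp: crd_y signs_def)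
    moreover have "norm (crd n y) \<le> 1" if "n \<notin> B" for n
      using that sg x_A order_trans[OF norm_coord_le_sup_norm x] by (auto simp: crd_y signs_def)
    ultimately have "greedy_set scl e y (card B) B"
      using fin by (simp add: greedy_set_def)
    moreover have "card B \<ge> 1"
      using False fin by (simp add: Suc_le_eq card_gt_0_iff)
    ultimately have "norm (y - prj B y) \<le> C * sigma_tilde scl e w B y"
      using ag by (simp add: almost_greedy_def)
    also have "\<dots> \<le> C * norm (y - prj A y)"
    proof (intro mult_left_mono sigma_tilde_le)
      show "w (A - B) \<le> w (B - A)"
        using wAB dj(1) by (simp add: Diff_triv Int_commute)
    qed (use fin C in auto)
    finally have "norm (y - prj B y) \<le> C * norm (y - prj A y)" .
    moreover have "prj B y = signed_sum scl e \<delta> B"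
      unfolding proj_def signed_sum_def using dj(1) x_B by (intro sum.cong) (auto simp: crd_y)
    moreover have "prj A y = signed_sum scl e \<epsilon> A"
      unfolding proj_def signed_sum_def using dj(1) x_A by (intro sum.cong) (auto simp: crd_y)
    ultimately show ?thesis
      by (simp add: y_def algebra_simps)
  qed
qed

section \<open>Truncation and the converse implication\<close>

text \<open>The subtracted sum cuts the coefficients on \<open>B\<close> down to modulus \<alpha>
  and keeps their phases. Since \<open>1 - \<alpha> / t\<close> increases with \<open>t\<close>, the
  superlevel sets of the weights are greedy sets of \<open>z\<close>, so the layer cake estimate
  applies with \<open>a = 1\<close>.\<close>

lemma suppression_quasi_greedy_truncation:
  assumes sqg: "suppression_quasi_greedy scl e C" and "finite B" and "\<alpha> > 0"
    and ge: "\<And>n. n \<in> B \<Longrightarrow> \<alpha> \<le> norm (crd n z)"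
    and le: "\<And>n. n \<notin> B \<Longrightarrow> norm (crd n z) \<le> \<alpha>"
  shows "norm (z - (\<Sum>n\<in>B. (1 - \<alpha> / norm (crd n z)) *\<^sub>R scl (crd n z) (e n))) \<le> C * norm z"
proof -
  have "norm (1 *\<^sub>R z - (\<Sum>n\<in>B. (1 - \<alpha> / norm (crd n z)) *\<^sub>R scl (crd n z) (e n))) \<le> 1 * (C * norm z)"
  proof (rule norm_diff_weighted_sum_le)
    show "0 \<le> 1 - \<alpha> / norm (crd n z) \<and> 1 - \<alpha> / norm (crd n z) \<le> 1" if "n \<in> B" for n
      using ge[OF that] \<open>\<alpha> > 0\<close> by (simp add: divide_le_eq_1)
    fix S
    assume S: "S \<subseteq> B" "\<forall>n\<in>S. \<forall>k\<in>B - S. 1 - \<alpha> / norm (crd k z) < 1 - \<alpha> / norm (crd n z)"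
    have C: "1 \<le> C"
      using sqg by (simp add: suppression_quasi_greedy_def)
    have "norm (crd k z) \<le> norm (crd n z)" if n: "n \<in> S" and k: "k \<notin> S" for n k
    proof (cases "k \<in> B")
      case True
      then have "\<alpha> / norm (crd n z) < \<alpha> / norm (crd k z)"
        using S(2) n k by force
      moreover have "norm (crd k z) > 0" "norm (crd n z) > 0"
        using ge[of k] ge[of n] True n S(1) \<open>\<alpha> > 0\<close> by (metis less_le_trans subsetD)+
      ultimately show ?thesis
        using \<open>\<alpha> > 0\<close> by (simp add: divide_less_cancel frac_less2 field_simps)
    next
      case False
      then show ?thesis
        using le[of k] ge[of n] n S(1) by force
    qed
    moreover have "finite S"
      using S(1) \<open>finite B\<close> by (rule finite_subset)
    ultimately have greedy: "greedy_set scl e z (card S) S"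
      by (simp add: greedy_set_def)
    have "norm (z - prj S z) \<le> C * norm z"
    \<comment> \<open>Quasi-greediness covers only orders at least 1; for empty \<open>S\<close> the
      bound is \<open>C \<ge> 1\<close>.\<close>
    proof (cases "S = {}")
      case True
      then show ?thesis
        using C by (simp add: proj_def mult_le_cancel_right1)
    next
      case False
      then have "card S \<ge> 1"
        using \<open>finite S\<close> by (simp add: Suc_le_eq card_gt_0_iff)
      then show ?thesis
        using sqg greedy by (simp add: suppression_quasi_greedy_def)
    qed
    then show "norm (z - (\<Sum>n\<in>S. scl (crd n z) (e n))) \<le> C * norm z"
      by (simp add: proj_def)
  qed (use \<open>finite B\<close> in auto)
  then show ?thesis
    by simp
qed

lemma proj_Un_disjoint:
  "finite A \<Longrightarrow> finite B \<Longrightarrow> A \<inter> B = {} \<Longrightarrow> prj (A \<union> B) x = prj A x + prj B x"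
  unfolding proj_def by (rule sum.union_disjoint)

lemma suppression_quasi_greedy_property_A_imp_almost_greedy:
  assumes "weight w"
    and sqg: "suppression_quasi_greedy scl e C\<^sub>l" and pA: "property_A scl e w C"
  shows "almost_greedy scl e w (C\<^sub>l * C)"
proof (rule almost_greedyI)
  have C: "1 \<le> C\<^sub>l" "1 \<le> C"
    using sqg pA by (simp_all add: suppression_quasi_greedy_def property_A_def)
  then show C1: "1 \<le> C\<^sub>l * C"
    using mult_mono[of 1 C\<^sub>l 1 C] by simp
  fix x m \<Lambda> A
  assume greedy: "greedy_set scl e x m \<Lambda>" and A: "finite A" "w (A - \<Lambda>) \<le> w (\<Lambda> - A)"
  then have \<Lambda>: "finite \<Lambda>" "\<And>n k. n \<in> \<Lambda> \<Longrightarrow> k \<notin> \<Lambda> \<Longrightarrow> norm (crd k x) \<le> norm (crd n x)"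
    by (auto simp: greedy_set_def)
  define B where "B = \<Lambda> - A"
  define D where "D = A - \<Lambda>"
  have fin: "finite B" "finite D"
    using A(1) \<Lambda>(1) by (auto simp: B_def D_def)
  show "norm (x - prj \<Lambda> x) \<le> C\<^sub>l * C * norm (x - prj A x)"
  proof (cases "B = {}")
    case True
    then have "D = {}"
      using A(2) assms(1) unfolding B_def D_def by (metis weight_def not_less)
    with True have "A = \<Lambda>"
      by (auto simp: B_def D_def)
    then show ?thesis
      using C1 by (simp add: mult_le_cancel_right1)
  next
    case False
    define \<alpha> where "\<alpha> = Min ((\<lambda>n. norm (crd n x)) ` B)"
    have ge: "\<alpha> \<le> norm (crd n x)" if "n \<in> B" for n
      using that fin unfolding \<alpha>_def by simp
    obtain n0 where n0: "n0 \<in> B" "norm (crd n0 x) = \<alpha>"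
      using False fin Min_in[of "(\<lambda>n. norm (crd n x)) ` B"] unfolding \<alpha>_def by fastforce
    \<comment> \<open>The minimum is attained at \<open>n0\<close> in the greedy set, so it bounds
      every coefficient outside that set.\<close>
    have le: "norm (crd n x) \<le> \<alpha>" if "n \<notin> \<Lambda>" for n
      using \<Lambda>(2)[of n0 n] n0 that by (auto simp: B_def)
    consider "\<alpha> = 0" | "\<alpha> > 0"
      using n0(2) by fastforce
    then show ?thesis
    proof cases
      case 1
      \<comment> \<open>All coefficients outside the greedy set vanish, so \<open>x\<close> is its
        own greedy sum. The other case divides by \<alpha>.\<close>
      then have "x - prj \<Lambda> x = 0"
        using le \<Lambda>(1) by (intro eq_zero_if_coord_zero) (simp add: coord_diff coord_proj)
      then show ?thesis
        using C1 by simp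
    next
      case 2
      define y where "y = x - prj (A \<union> \<Lambda>) x"
      define z where "z = x - prj A x"
      have crd_y: "crd n y = (if n \<in> A \<union> \<Lambda> then 0 else crd n x)" for n
        using A(1) \<Lambda>(1) by (simp add: y_def coord_diff coord_proj)
      have crd_z: "crd n z = (if n \<in> A then 0 else crd n x)" for n
        using A(1) by (simp add: z_def coord_diff coord_proj)
      have "prj (A \<union> \<Lambda>) x = prj \<Lambda> x + prj D x"
        using proj_Un_disjoint[of \<Lambda> D] \<Lambda>(1) fin by (auto simp: D_def Un_commute)
      then have x_eq: "x - prj \<Lambda> x = y + prj D x"
        by (simp add: y_def)
      have "prj (A \<union> \<Lambda>) x = prj A x + prj B x"
        using proj_Un_disjoint[of A B] A(1) fin by (auto simp: B_def)
      then have z_eq: "z = y + prj B x"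
        by (simp add: y_def z_def)
      \<comment> \<open>The phases of \<open>x\<close> on \<open>B\<close>; the value 1 elsewhere
        only makes this a sign sequence.\<close>
      define \<delta> where "\<delta> n = (if n \<in> B then crd n x / of_real (norm (crd n x)) else 1)" for n
      have "crd n x \<noteq> 0" if "n \<in> B" for n
        using ge[OF that] 2 by auto
      then have \<delta>: "signs \<delta>"
        by (simp add: signs_def \<delta>_def norm_divide)
      have sum_z: "z - (\<Sum>n\<in>B. (1 - \<alpha> / norm (crd n z)) *\<^sub>R scl (crd n z) (e n)) =
          y + \<alpha> *\<^sub>R signed_sum scl e \<delta> B"
      proof -
        have "(1 - \<alpha> / norm (crd n z)) *\<^sub>R scl (crd n z) (e n) =
            scl (crd n x) (e n) - \<alpha> *\<^sub>R scl (\<delta> n) (e n)" if "n \<in> B" for n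
        proof -
          have "crd n z = crd n x"
            using that by (simp add: crd_z B_def)
          moreover have "\<alpha> *\<^sub>R scl (\<delta> n) (e n) = (\<alpha> / norm (crd n x)) *\<^sub>R scl (crd n x) (e n)"
            using that by (simp add: \<delta>_def flip: scl_of_real)
          ultimately show ?thesis
            by (simp add: scaleR_diff_left)
        qed
        then show ?thesis
          by (simp add: z_eq proj_def signed_sum_def sum_subtractf scaleR_sum_right)
      qed
      have truncated: "norm (y + \<alpha> *\<^sub>R signed_sum scl e \<delta> B) \<le> C\<^sub>l * norm z"
        unfolding sum_z[symmetric]
      proof (rule suppression_quasi_greedy_truncation[OF sqg fin(1) 2])
        show "\<alpha> \<le> norm (crd n z)" if "n \<in> B" for n
          using ge[OF that] that by (simp add: crd_z B_def)
        \<comment> \<open>An index outside \<open>B\<close> lies in \<open>A\<close>, where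
          \<open>z\<close> has coefficient 0, or outside the greedy set, where \<open>le\<close>
          applies.\<close>
        show "norm (crd n z) \<le> \<alpha>" if "n \<notin> B" for n
          using le[of n] that 2 by (auto simp: crd_z B_def)
      qed
      \<comment> \<open>Property (A) requires coefficients of modulus at most 1, hence the
        rescaling.\<close>
      define y' where "y' = (1 / \<alpha>) *\<^sub>R y"
      have y: "y = \<alpha> *\<^sub>R y'"
        using 2 by (simp add: y'_def)
      have crd_y': "crd n y' = of_real (1 / \<alpha>) * crd n y" for n
        unfolding y'_def by (rule coord_scaleR)
      have "sup_norm scl e y' \<le> 1"
        unfolding sup_norm_def
      proof (rule cSUP_least)
        show "norm (crd n y') \<le> 1" for n
          using le[of n] 2 by (simp add: crd_y' crd_y norm_mult norm_divide)
      qed simp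
      moreover have "D \<inter> supp scl e y' = {}" "B \<inter> supp scl e y' = {}"
        by (auto simp: supp_def crd_y' crd_y B_def D_def)
      moreover have "D \<inter> B = {}" "w D \<le> w B"
        using A(2) by (auto simp: B_def D_def)
      ultimately have prop_A: "norm (y' + signed_sum scl e \<epsilon> D) \<le> C * norm (y' + signed_sum scl e \<delta> B)"
        if "signs \<epsilon>" for \<epsilon>
        using pA that \<delta> fin unfolding property_A_def by blast
      \<comment> \<open>Convexity turns the bounds for all signed sums over \<open>D\<close> into
        one for the true coefficients of \<open>x\<close> there.\<close>
      have "norm (y + prj D x) \<le> C * norm (y + \<alpha> *\<^sub>R signed_sum scl e \<delta> B)"
        unfolding proj_def
      proof (rule norm_add_sum_le_if_signed_sums[OF fin(2) 2])
        show "norm (crd n x) \<le> \<alpha>" if "n \<in> D" for n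
          using le[of n] that by (simp add: D_def)
        show "norm (y + \<alpha> *\<^sub>R signed_sum scl e \<epsilon> D) \<le> C * norm (y + \<alpha> *\<^sub>R signed_sum scl e \<delta> B)"
          if "signs \<epsilon>" for \<epsilon>
          using mult_left_mono[OF prop_A[OF that], of \<alpha>] 2
          by (simp add: y mult.left_commute flip: scaleR_add_right)
      qed
      also have "\<dots> \<le> C * (C\<^sub>l * norm z)"
        using truncated C by (intro mult_left_mono) auto
      finally show ?thesis
        by (simp add: x_eq z_def mult_ac)
    qed
  qed
qed

end

theorem theorem2p9:
  fixes scl :: "'k::real_normed_field \<Rightarrow> 'a::banach \<Rightarrow> 'a"
    and e :: "nat \<Rightarrow> 'a"
    and w :: "nat set \<Rightarrow> ennreal"
  assumes "banach_space_over scl"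
    and "basis scl e"
    and "weight w"
  shows "(\<forall>C. almost_greedy scl e w C \<longrightarrow>
            suppression_quasi_greedy scl e C \<and> property_A scl e w C) \<and>
         (\<forall>C\<^sub>l C. suppression_quasi_greedy scl e C\<^sub>l \<and> property_A scl e w C \<longrightarrow>
            almost_greedy scl e w (C\<^sub>l * C))"
proof -
  interpret banach_space_with_basis scl e
    using assms(1,2) by (simp add: banach_space_with_basis_def banach_space_with_basis_axioms_def)
  show ?thesis
    using assms(3) almost_greedy_imp_suppression_quasi_greedy almost_greedy_imp_property_A
      suppression_quasi_greedy_property_A_imp_almost_greedy by blast
qed

end
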